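(* For all names $u,v$: (K0) $\mathrm{GClosurePoint}(\Lambda)=_{pt}\Lambda$; (K1) $u\subseteq_{pt}\mathrm{GClosurePoint}(u)$; (K2) $\mathrm{GClosurePoint}(u\cup_{pt}v)=_{pt}\mathrm{GClosurePoint}(u)\cup_{pt}\mathrm{GClosurePoint}(v)$; (K3) $\mathrm{GClosurePoint}(\mathrm{GClosurePoint}(u))=_{pt}\mathrm{GClosurePoint}(u)$.
   Context: Logic is classical. Names form a type $N$; a name may designate zero, one or several objects. The relation $\eta : N\to N\to \mathrm{Prop}$ (singular inclusion) is governed by Leśniewski's Ontology: $\eta\,A\,b$ holds iff [there is $C$ with $\eta\,C\,A$] and [for all $C,D$, $\eta\,C\,A$ and $\eta\,D\,A$ imply $\eta\,C\,D$] and [for all $C$, $\eta\,C\,A$ implies $\eta\,C\,b$]; i.e. $A$ designates exactly one object, which is among those designated by $b$. $A$ is an Individual iff $\eta\,A\,A$. $\Lambda$ is the empty name (no $P$ satisfies $\eta\,P\,\Lambda$). Notation: $P\equiv Q$ iff $\eta\,P\,Q$ and $\eta\,Q\,P$; $a\approx b$ iff $\forall P,\ \eta\,P\,a\leftrightarrow\eta\,P\,b$. Names with the same extension are interchangeable. Name-forming operators are introduced by stating when $\eta\,P\,(\cdot)$ holds. Mereology: $\eta\,P\,(\mathrm{pt}(Q))$ ("$P$ is a part of $Q$") relates individuals and is reflexive on individuals, transitive, and antisymmetric up to $\equiv$; a proper part of $Q$ is a part $P$ with not $P\equiv Q$; $\eta\,P\,(\mathrm{ext}(Q))$ ("$P$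 is external to $Q$") means $P,Q$ are individuals with no common part. Geometry: $\mathrm{balls}$ is a primitive name whose members are individuals (balls); at least one ball exists. $\eta\,P\,(\mathrm{Concent}(Q))$ means that the balls $P,Q$ are concentric in Tarski's sense: $P\equiv Q$; or $P$ is a proper part of $Q$ and any two balls $X,Y$ externally diametrical to $P$ and internally tangent to $Q$ are internally diametrical to $Q$; or the same with $P,Q$ exchanged. Here (all variables balls): $A$ is externally tangent to $B$ if $A$ is external to $B$ and of any two balls $X,Y$ having $A$ as part and external to $B$ one is part of the other; $A$ is internally tangent to $B$ if $A$ is a proper part of $B$ and of any two balls $X,Y$ having $A$ as part and being parts of $B$ one is part of the other; $A,B$ are externally diametrical to $C$ if both are externally tangent to $C$ and whenever $X,Y$ are external to $C$, $A$ is part of $X$ and $B$ is part of $Y$, then $X$ is external to $Y$; $A,B$ are internally diametrical to $C$ if both are internally tangent to $C$ and whenever $X,Y$ are external to $C$, $A$ is externally tangent to $X$ and $B$ to $Y$, then $X$ is external to $Y$. $\eta\,P\,(\mathrm{Point}(Q))$ iff $\eta\,P\,\mathrm{balls}$, $\eta\,Q\,\mathrm{balls}$ and $\eta\,P\,(\mathrm{Concent}(Q))$. Standing assumptions: concentricity is an equivalence relation on balls, and concentric balls $P,Q$ satisfy $\mathrm{Point}(P)\approx\mathrm{Point}(Q)$. Point-class notions: $\mathrm{same\_center}(P,Q)$ iff $\mathrm{Point}(P)\approx\mathrm{Point}(Q)$. $u=_{pt}v$ iff for all $B$ with $\eta\,B\,\mathrm{balls}$, $\eta\,B\,u\leftrightarrow\eta\,B\,v$.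 $u\subseteq_{pt}v$ iff for all $B$ with $\eta\,B\,\mathrm{balls}$, $\eta\,B\,u$ implies $\eta\,B\,v$. $\eta\,B\,(u\cup_{pt}v)$ iff $\eta\,B\,\mathrm{balls}$ and ($\eta\,B\,u$ or $\eta\,B\,v$). $\mathrm{PointSet\_stable}(u)$ iff for all $B,C$, $\mathrm{same\_center}(B,C)$ and $\eta\,B\,u$ imply $\eta\,C\,u$. $\mathrm{PointSet\_meet}(u,v)$ iff there are $B,C$ with $\eta\,B\,\mathrm{balls}$, $\eta\,C\,\mathrm{balls}$, $\mathrm{same\_center}(B,C)$, $\eta\,B\,u$ and $\eta\,C\,v$. $\eta\,P\,\mathrm{GBasicPointSet}(Q)$ iff $\eta\,Q\,\mathrm{balls}$, $\eta\,P\,\mathrm{balls}$ and there is $C$ with $\eta\,C\,\mathrm{balls}$, $\mathrm{same\_center}(P,C)$ and $\eta\,C\,(\mathrm{pt}(Q))$. $\mathrm{GPointOpen}(u)$ iff $\mathrm{PointSet\_stable}(u)$; and every $P$ with $\eta\,P\,u$ satisfies $\eta\,P\,\mathrm{balls}$; and for every $P$ with $\eta\,P\,u$ there is $Q$ with $\eta\,Q\,\mathrm{balls}$, $\eta\,P\,\mathrm{GBasicPointSet}(Q)$ and $\mathrm{GBasicPointSet}(Q)\subseteq_{pt}u$. $\eta\,P\,\mathrm{GClosurePoint}(u)$ iff $\eta\,P\,\mathrm{balls}$ and for every $v$ with $\mathrm{GPointOpen}(v)$ and $\eta\,P\,v$, $\mathrm{PointSet\_meet}(v,u)$. *)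

theory Defs
  imports Main
begin

text \<open>
  Names form a type \<open>'a\<close> with singular inclusion \<open>\<eta>\<close>. Besides Lesniewski's axiom there are two
  background principles. That names with the same extension are interchangeable is, in
  higher-order logic, the statement that they are equal. That a name-forming operator may be
  introduced by stating when \<open>\<eta> P (\<dots>)\<close> holds is the comprehension principle below; the conjunct
  \<open>\<eta> P P\<close> is needed because \<open>\<eta> P a\<close> always makes \<open>P\<close> an individual.
\<close>

class ontology =
  fixes \<eta> :: "'a \<Rightarrow> 'a \<Rightarrow> bool"
  assumes eta_iff: "\<eta> A b \<longleftrightarrow>
      (\<exists>C. \<eta> C A) \<and> (\<forall>C D. \<eta> C A \<and> \<eta> D A \<longrightarrow> \<eta> C D) \<and> (\<forall>C. \<eta> C A \<longrightarrow> \<eta> C b)"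
    and extensionality: "(\<forall>P. \<eta> P a \<longleftrightarrow> \<eta> P b) \<Longrightarrow> a = b"
    and comprehension: "\<exists>a. \<forall>P. \<eta> P a \<longleftrightarrow> \<eta> P P \<and> \<phi> P"
begin

definition Individual :: "'a \<Rightarrow> bool" where
  "Individual A \<longleftrightarrow> \<eta> A A"

definition name_of :: "('a \<Rightarrow> bool) \<Rightarrow> 'a" where
  "name_of \<phi> = (THE a. \<forall>P. \<eta> P a \<longleftrightarrow> \<eta> P P \<and> \<phi> P)"

definition Lambda :: 'a (\<open>\<Lambda>\<close>) where
  "\<Lambda> = name_of (\<lambda>P. False)"

definition same_individual :: "'a \<Rightarrow> 'a \<Rightarrow> bool" (infix \<open>\<cong>\<close> 50) where
  "P \<cong> Q \<longleftrightarrow> \<eta> P Q \<and> \<eta> Q P"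

definition coextensive :: "'a \<Rightarrow> 'a \<Rightarrow> bool" (infix \<open>\<approx>\<close> 50) where
  "a \<approx> b \<longleftrightarrow> (\<forall>P. \<eta> P a \<longleftrightarrow> \<eta> P b)"

lemma eta_individual: "\<eta> P a \<Longrightarrow> \<eta> P P"
  by (drule iffD1[OF eta_iff], rule iffD2[OF eta_iff]) blast

lemma eta_name_of: "\<eta> P (name_of \<phi>) \<longleftrightarrow> \<eta> P P \<and> \<phi> P"
proof -
  have "\<exists>!a. \<forall>P. \<eta> P a \<longleftrightarrow> \<eta> P P \<and> \<phi> P"
  proof (rule ex_ex1I)
    show "\<exists>a. \<forall>P. \<eta> P a \<longleftrightarrow> \<eta> P P \<and> \<phi> P" by (rule comprehension)
  next
    fix a b
    assume "\<forall>P. \<eta> P a \<longleftrightarrow> \<eta> P P \<and> \<phi> P" "\<forall>P. \<eta> P b \<longleftrightarrow> \<eta> P P \<and> \<phi> P"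
    then show "a = b" by (intro extensionality) blast
  qed
  from theI'[OF this] show ?thesis unfolding name_of_def by blast
qed

lemma eta_Lambda: "\<not> \<eta> P \<Lambda>"
  by (simp add: Lambda_def eta_name_of)

end

class mereology = ontology +
  fixes pt :: "'a \<Rightarrow> 'a"
  assumes pt_individuals: "\<eta> P (pt Q) \<Longrightarrow> Individual P \<and> Individual Q"
    and pt_refl: "Individual P \<Longrightarrow> \<eta> P (pt P)"
    and pt_trans: "\<eta> P (pt Q) \<Longrightarrow> \<eta> Q (pt R) \<Longrightarrow> \<eta> P (pt R)"
    and pt_antisym: "\<eta> P (pt Q) \<Longrightarrow> \<eta> Q (pt P) \<Longrightarrow> P \<cong> Q"
begin

definition proper_part :: "'a \<Rightarrow> 'a \<Rightarrow> bool" where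
  "proper_part P Q \<longleftrightarrow> \<eta> P (pt Q) \<and> \<not> P \<cong> Q"

definition ext :: "'a \<Rightarrow> 'a" where
  "ext Q = name_of (\<lambda>P. Individual P \<and> Individual Q \<and> \<not> (\<exists>R. \<eta> R (pt P) \<and> \<eta> R (pt Q)))"

lemma eta_ext:
  "\<eta> P (ext Q) \<longleftrightarrow> Individual P \<and> Individual Q \<and> \<not> (\<exists>R. \<eta> R (pt P) \<and> \<eta> R (pt Q))"
  by (auto simp: ext_def eta_name_of Individual_def)

end

class ball_mereology = mereology +
  fixes balls :: 'a
  assumes ex_ball: "\<exists>B. \<eta> B balls"
begin

definition ext_tangent :: "'a \<Rightarrow> 'a \<Rightarrow> bool" where
  "ext_tangent A B \<longleftrightarrow> \<eta> A balls \<and> \<eta> B balls \<and> \<eta> A (ext B) \<and>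
     (\<forall>X Y. \<eta> X balls \<and> \<eta> Y balls \<and>
        \<eta> A (pt X) \<and> \<eta> X (ext B) \<and> \<eta> A (pt Y) \<and> \<eta> Y (ext B)
        \<longrightarrow> \<eta> X (pt Y) \<or> \<eta> Y (pt X))"

definition int_tangent :: "'a \<Rightarrow> 'a \<Rightarrow> bool" where
  "int_tangent A B \<longleftrightarrow> \<eta> A balls \<and> \<eta> B balls \<and> proper_part A B \<and>
     (\<forall>X Y. \<eta> X balls \<and> \<eta> Y balls \<and>
        \<eta> A (pt X) \<and> \<eta> X (pt B) \<and> \<eta> A (pt Y) \<and> \<eta> Y (pt B)
        \<longrightarrow> \<eta> X (pt Y) \<or> \<eta> Y (pt X))"

definition ext_diametrical :: "'a \<Rightarrow> 'a \<Rightarrow> 'a \<Rightarrow> bool" where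
  "ext_diametrical A B C \<longleftrightarrow> ext_tangent A C \<and> ext_tangent B C \<and>
     (\<forall>X Y. \<eta> X balls \<and> \<eta> Y balls \<and>
        \<eta> X (ext C) \<and> \<eta> Y (ext C) \<and> \<eta> A (pt X) \<and> \<eta> B (pt Y)
        \<longrightarrow> \<eta> X (ext Y))"

definition int_diametrical :: "'a \<Rightarrow> 'a \<Rightarrow> 'a \<Rightarrow> bool" where
  "int_diametrical A B C \<longleftrightarrow> int_tangent A C \<and> int_tangent B C \<and>
     (\<forall>X Y. \<eta> X balls \<and> \<eta> Y balls \<and>
        \<eta> X (ext C) \<and> \<eta> Y (ext C) \<and> ext_tangent A X \<and> ext_tangent B Y
        \<longrightarrow> \<eta> X (ext Y))"

text \<open>The case of Tarski's definition of concentricity in which \<open>P\<close> is the smaller ball.\<close>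

definition inner_concentric :: "'a \<Rightarrow> 'a \<Rightarrow> bool" where
  "inner_concentric P Q \<longleftrightarrow> proper_part P Q \<and>
     (\<forall>X Y. \<eta> X balls \<and> \<eta> Y balls \<and>
        ext_diametrical X Y P \<and> int_tangent X Q \<and> int_tangent Y Q
        \<longrightarrow> int_diametrical X Y Q)"

definition Concent :: "'a \<Rightarrow> 'a" where
  "Concent Q = name_of (\<lambda>P. \<eta> P balls \<and> \<eta> Q balls \<and>
     (P \<cong> Q \<or> inner_concentric P Q \<or> inner_concentric Q P))"

definition Point :: "'a \<Rightarrow> 'a" where
  "Point Q = name_of (\<lambda>P. \<eta> P balls \<and> \<eta> Q balls \<and> \<eta> P (Concent Q))"

lemma eta_Concent:
  "\<eta> P (Concent Q) \<longleftrightarrow> \<eta> P balls \<and> \<eta> Q balls \<and>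
     (P \<cong> Q \<or> inner_concentric P Q \<or> inner_concentric Q P)"
  by (auto simp: Concent_def eta_name_of dest: eta_individual)

lemma eta_Point: "\<eta> P (Point Q) \<longleftrightarrow> \<eta> P balls \<and> \<eta> Q balls \<and> \<eta> P (Concent Q)"
  by (auto simp: Point_def eta_name_of dest: eta_individual)

end

class ball_geometry = ball_mereology +
  assumes Concent_refl: "\<eta> P balls \<Longrightarrow> \<eta> P (Concent P)"
    and Concent_sym: "\<eta> P balls \<Longrightarrow> \<eta> Q balls \<Longrightarrow> \<eta> P (Concent Q) \<Longrightarrow> \<eta> Q (Concent P)"
    and Concent_trans: "\<eta> P balls \<Longrightarrow> \<eta> Q balls \<Longrightarrow> \<eta> R balls \<Longrightarrow>
      \<eta> P (Concent Q) \<Longrightarrow> \<eta> Q (Concent R) \<Longrightarrow> \<eta> P (Concent R)"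
    and Concent_Point: "\<eta> P balls \<Longrightarrow> \<eta> Q balls \<Longrightarrow> \<eta> P (Concent Q) \<Longrightarrow> Point P \<approx> Point Q"
begin

definition same_center :: "'a \<Rightarrow> 'a \<Rightarrow> bool" where
  "same_center P Q \<longleftrightarrow> Point P \<approx> Point Q"

definition pt_eq :: "'a \<Rightarrow> 'a \<Rightarrow> bool" (infix \<open>=\<^sub>p\<^sub>t\<close> 50) where
  "u =\<^sub>p\<^sub>t v \<longleftrightarrow> (\<forall>B. \<eta> B balls \<longrightarrow> (\<eta> B u \<longleftrightarrow> \<eta> B v))"

definition pt_subseteq :: "'a \<Rightarrow> 'a \<Rightarrow> bool" (infix \<open>\<subseteq>\<^sub>p\<^sub>t\<close> 50) where
  "u \<subseteq>\<^sub>p\<^sub>t v \<longleftrightarrow> (\<forall>B. \<eta> B balls \<longrightarrow> \<eta> B u \<longrightarrow> \<eta> B v)"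

definition pt_union :: "'a \<Rightarrow> 'a \<Rightarrow> 'a" (infixl \<open>\<union>\<^sub>p\<^sub>t\<close> 65) where
  "u \<union>\<^sub>p\<^sub>t v = name_of (\<lambda>B. \<eta> B balls \<and> (\<eta> B u \<or> \<eta> B v))"

definition PointSet_stable :: "'a \<Rightarrow> bool" where
  "PointSet_stable u \<longleftrightarrow> (\<forall>B C. same_center B C \<and> \<eta> B u \<longrightarrow> \<eta> C u)"

definition PointSet_meet :: "'a \<Rightarrow> 'a \<Rightarrow> bool" where
  "PointSet_meet u v \<longleftrightarrow>
     (\<exists>B C. \<eta> B balls \<and> \<eta> C balls \<and> same_center B C \<and> \<eta> B u \<and> \<eta> C v)"

definition GBasicPointSet :: "'a \<Rightarrow> 'a" where
  "GBasicPointSet Q = name_of (\<lambda>P. \<eta> Q balls \<and> \<eta> P balls \<and>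
     (\<exists>C. \<eta> C balls \<and> same_center P C \<and> \<eta> C (pt Q)))"

definition GPointOpen :: "'a \<Rightarrow> bool" where
  "GPointOpen u \<longleftrightarrow> PointSet_stable u \<and> (\<forall>P. \<eta> P u \<longrightarrow> \<eta> P balls) \<and>
     (\<forall>P. \<eta> P u \<longrightarrow>
        (\<exists>Q. \<eta> Q balls \<and> \<eta> P (GBasicPointSet Q) \<and> GBasicPointSet Q \<subseteq>\<^sub>p\<^sub>t u))"

definition GClosurePoint :: "'a \<Rightarrow> 'a" where
  "GClosurePoint u = name_of (\<lambda>P. \<eta> P balls \<and>
     (\<forall>v. GPointOpen v \<and> \<eta> P v \<longrightarrow> PointSet_meet v u))"

lemma eta_pt_union: "\<eta> B (u \<union>\<^sub>p\<^sub>t v) \<longleftrightarrow> \<eta> B balls \<and> (\<eta> B u \<or> \<eta> B v)"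
  by (auto simp: pt_union_def eta_name_of dest: eta_individual)

lemma eta_GBasicPointSet:
  "\<eta> P (GBasicPointSet Q) \<longleftrightarrow> \<eta> Q balls \<and> \<eta> P balls \<and>
     (\<exists>C. \<eta> C balls \<and> same_center P C \<and> \<eta> C (pt Q))"
  by (auto simp: GBasicPointSet_def eta_name_of dest: eta_individual)

lemma eta_GClosurePoint:
  "\<eta> P (GClosurePoint u) \<longleftrightarrow> \<eta> P balls \<and>
     (\<forall>v. GPointOpen v \<and> \<eta> P v \<longrightarrow> PointSet_meet v u)"
  by (auto simp: GClosurePoint_def eta_name_of dest: eta_individual)

end

end

theory Submission
  imports Defs
begin

text \<open>
  Closure points are defined by open neighbourhoods, so the Kuratowski laws hold as in any
  topological space once two facts about open names are known: the name of all balls is open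
  (\<open>GPointOpen_balls\<close>), and open names are closed under binary intersection
  (\<open>GPointOpen_point_inter\<close>).

  The second fact is where geometry enters. If \<open>P\<close> lies in the basic sets of \<open>Q\<close> and \<open>R\<close>, then
  some ball \<open>C\<close> with the center of \<open>P\<close> is part of \<open>Q\<close> and some ball \<open>D\<close> with the same center is
  part of \<open>R\<close>. Tarski's definition makes concentric balls nested, so the smaller of \<open>C\<close> and \<open>D\<close>
  is part of both \<open>Q\<close> and \<open>R\<close>, and its basic set is a neighbourhood of \<open>P\<close> inside both basic sets
  (\<open>GBasicPointSet_directed\<close>).

  The set \<open>u\<close> whose closure is taken may contain a ball without containing all balls
  concentric with it. Open names are stable, and this suffices: a name meets an open name up to
  concentricity exactly when the two share a ball (\<open>PointSet_meet_open_iff\<close>).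
\<close>

context ball_geometry
begin

lemma same_center_refl: "same_center B B"
  by (simp add: same_center_def coextensive_def)

lemma same_center_sym: "same_center B C \<Longrightarrow> same_center C B"
  by (simp add: same_center_def coextensive_def)

lemma same_center_trans: "same_center B C \<Longrightarrow> same_center C D \<Longrightarrow> same_center B D"
  by (simp add: same_center_def coextensive_def)

lemma ball_part_refl: "\<eta> B balls \<Longrightarrow> \<eta> B (pt B)"
  by (simp add: pt_refl Individual_def eta_individual)

text \<open>A ball \<open>B\<close> is a member of \<open>Point B\<close>, hence of \<open>Point C\<close> when the two agree; so having the same
  center as a ball already makes \<open>C\<close> a ball concentric with it.\<close>

lemma same_center_imp_Concent:
  assumes "same_center B C" "\<eta> B balls"
  shows "\<eta> C balls" "\<eta> B (Concent C)"
proof -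
  have "\<eta> B (Point B)"
    using assms(2) by (simp add: eta_Point Concent_refl)
  then have "\<eta> B (Point C)"
    using assms(1) by (simp add: same_center_def coextensive_def)
  then show "\<eta> C balls" "\<eta> B (Concent C)"
    by (simp_all add: eta_Point)
qed

lemma same_individual_imp_eq: "B \<cong> C \<Longrightarrow> B = C"
  unfolding same_individual_def
  by (rule extensionality) (metis eta_iff)

text \<open>Each case of Tarski's definition of concentricity contains a parthood: either the balls are
  the same, or one is a proper part of the other.\<close>

lemma same_center_imp_nested:
  assumes "same_center B C" "\<eta> B balls"
  shows "\<eta> B (pt C) \<or> \<eta> C (pt B)"
proof -
  have "B \<cong> C \<or> inner_concentric B C \<or> inner_concentric C B"
    using same_center_imp_Concent[OF assms] by (simp add: eta_Concent)
  then show ?thesis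
    using ball_part_refl[OF assms(2)] same_individual_imp_eq
    by (auto simp: inner_concentric_def proper_part_def)
qed

lemma GBasicPointSet_self: "\<eta> B balls \<Longrightarrow> \<eta> B (GBasicPointSet B)"
  using ball_part_refl same_center_refl by (auto simp: eta_GBasicPointSet)

lemma GBasicPointSet_mono:
  assumes "\<eta> C (pt Q)" "\<eta> Q balls"
  shows "GBasicPointSet C \<subseteq>\<^sub>p\<^sub>t GBasicPointSet Q"
  using assms pt_trans by (auto simp: pt_subseteq_def eta_GBasicPointSet)

lemma pt_subseteq_trans: "u \<subseteq>\<^sub>p\<^sub>t v \<Longrightarrow> v \<subseteq>\<^sub>p\<^sub>t w \<Longrightarrow> u \<subseteq>\<^sub>p\<^sub>t w"
  by (simp add: pt_subseteq_def)

text \<open>Basic sets around a common point are directed, by nestedness of concentric balls.\<close>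

lemma GBasicPointSet_directed:
  assumes "\<eta> P (GBasicPointSet Q)" "\<eta> P (GBasicPointSet R)"
  obtains S where "\<eta> S balls" "\<eta> P (GBasicPointSet S)"
    "GBasicPointSet S \<subseteq>\<^sub>p\<^sub>t GBasicPointSet Q" "GBasicPointSet S \<subseteq>\<^sub>p\<^sub>t GBasicPointSet R"
proof -
  have balls: "\<eta> P balls" "\<eta> Q balls" "\<eta> R balls"
    using assms by (auto simp: eta_GBasicPointSet)
  obtain C where C: "\<eta> C balls" "same_center P C" "\<eta> C (pt Q)"
    using assms(1) by (auto simp: eta_GBasicPointSet)
  obtain D where D: "\<eta> D balls" "same_center P D" "\<eta> D (pt R)"
    using assms(2) by (auto simp: eta_GBasicPointSet)
  have "\<eta> C (pt D) \<or> \<eta> D (pt C)"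
    using same_center_imp_nested same_center_trans[OF same_center_sym[OF C(2)] D(2)] C(1) .
  \<comment> \<open>\<open>S\<close> is the smaller of the two concentric balls.\<close>
  then obtain S where S: "\<eta> S balls" "same_center P S" "\<eta> S (pt Q)" "\<eta> S (pt R)"
    using C D pt_trans by blast
  show thesis
  proof (rule that)
    show "\<eta> P (GBasicPointSet S)"
      using S balls ball_part_refl by (auto simp: eta_GBasicPointSet)
  qed (use S balls GBasicPointSet_mono in auto)
qed

lemma GPointOpen_balls: "GPointOpen balls"
  unfolding GPointOpen_def PointSet_stable_def
  using same_center_imp_Concent(1) GBasicPointSet_self
  by (auto simp: pt_subseteq_def)

definition point_inter :: "'a \<Rightarrow> 'a \<Rightarrow> 'a" where
  "point_inter u v = name_of (\<lambda>B. \<eta> B u \<and> \<eta> B v)"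

lemma eta_point_inter: "\<eta> B (point_inter u v) \<longleftrightarrow> \<eta> B u \<and> \<eta> B v"
  by (auto simp: point_inter_def eta_name_of dest: eta_individual)

lemma GPointOpen_point_inter:
  assumes "GPointOpen u" "GPointOpen v"
  shows "GPointOpen (point_inter u v)"
proof -
  have "\<exists>S. \<eta> S balls \<and> \<eta> P (GBasicPointSet S) \<and> GBasicPointSet S \<subseteq>\<^sub>p\<^sub>t point_inter u v"
    if Pu: "\<eta> P u" and Pv: "\<eta> P v" for P
  proof -
    obtain Q where Q: "\<eta> P (GBasicPointSet Q)" "GBasicPointSet Q \<subseteq>\<^sub>p\<^sub>t u"
      using assms(1) Pu unfolding GPointOpen_def by blast
    obtain R where R: "\<eta> P (GBasicPointSet R)" "GBasicPointSet R \<subseteq>\<^sub>p\<^sub>t v"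
      using assms(2) Pv unfolding GPointOpen_def by blast
    obtain S where S: "\<eta> S balls" "\<eta> P (GBasicPointSet S)"
      "GBasicPointSet S \<subseteq>\<^sub>p\<^sub>t GBasicPointSet Q" "GBasicPointSet S \<subseteq>\<^sub>p\<^sub>t GBasicPointSet R"
      using GBasicPointSet_directed[OF Q(1) R(1)] .
    have "GBasicPointSet S \<subseteq>\<^sub>p\<^sub>t u" "GBasicPointSet S \<subseteq>\<^sub>p\<^sub>t v"
      using S(3,4) Q(2) R(2) pt_subseteq_trans by blast+
    then show ?thesis
      using S(1,2) by (auto simp: pt_subseteq_def eta_point_inter)
  qed
  moreover have "PointSet_stable (point_inter u v)"
    using assms unfolding GPointOpen_def PointSet_stable_def eta_point_inter by blast
  ultimately show ?thesis
    using assms by (simp add: GPointOpen_def eta_point_inter)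
qed

text \<open>Stability of the open name moves the witness of a meeting onto a single ball.\<close>

lemma PointSet_meet_open_iff:
  assumes "GPointOpen v"
  shows "PointSet_meet v u \<longleftrightarrow> (\<exists>C. \<eta> C v \<and> \<eta> C u)"
  using assms same_center_refl
  unfolding GPointOpen_def PointSet_stable_def PointSet_meet_def by blast

lemma eta_GClosurePoint_iff:
  "\<eta> P (GClosurePoint u) \<longleftrightarrow>
     \<eta> P balls \<and> (\<forall>v. GPointOpen v \<and> \<eta> P v \<longrightarrow> (\<exists>C. \<eta> C v \<and> \<eta> C u))"
  using PointSet_meet_open_iff by (auto simp: eta_GClosurePoint)

lemma GClosurePoint_Lambda: "GClosurePoint \<Lambda> =\<^sub>p\<^sub>t \<Lambda>"
  using GPointOpen_balls by (auto simp: pt_eq_def eta_GClosurePoint_iff eta_Lambda)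

lemma GClosurePoint_extensive: "u \<subseteq>\<^sub>p\<^sub>t GClosurePoint u"
  by (auto simp: pt_subseteq_def eta_GClosurePoint_iff)

text \<open>If \<open>P\<close> has one open neighbourhood missing \<open>u\<close> and another missing \<open>v\<close>, their intersection is
  an open neighbourhood missing both.\<close>

lemma GClosurePoint_union:
  "GClosurePoint (u \<union>\<^sub>p\<^sub>t v) =\<^sub>p\<^sub>t GClosurePoint u \<union>\<^sub>p\<^sub>t GClosurePoint v"
proof -
  have "\<eta> P (GClosurePoint u) \<or> \<eta> P (GClosurePoint v)"
    if P: "\<eta> P (GClosurePoint (u \<union>\<^sub>p\<^sub>t v))" for P
  proof (rule ccontr)
    assume not: "\<not> ?thesis"
    have "\<eta> P balls"
      using P by (simp add: eta_GClosurePoint_iff)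
    with not obtain a b where ab: "GPointOpen a" "\<eta> P a" "\<not> (\<exists>C. \<eta> C a \<and> \<eta> C u)"
      "GPointOpen b" "\<eta> P b" "\<not> (\<exists>C. \<eta> C b \<and> \<eta> C v)"
      by (auto simp: eta_GClosurePoint_iff)
    have "GPointOpen (point_inter a b)" "\<eta> P (point_inter a b)"
      using ab GPointOpen_point_inter by (auto simp: eta_point_inter)
    with P obtain C where "\<eta> C (point_inter a b)" "\<eta> C (u \<union>\<^sub>p\<^sub>t v)"
      by (auto simp: eta_GClosurePoint_iff)
    with ab show False
      by (auto simp: eta_point_inter eta_pt_union)
  qed
  moreover have "\<eta> P (GClosurePoint (u \<union>\<^sub>p\<^sub>t v))"
    if P: "\<eta> P (GClosurePoint u) \<or> \<eta> P (GClosurePoint v)" for P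
  proof -
    have "\<exists>C. \<eta> C w \<and> \<eta> C (u \<union>\<^sub>p\<^sub>t v)" if w: "GPointOpen w" "\<eta> P w" for w
    proof -
      obtain C where "\<eta> C w" "\<eta> C u \<or> \<eta> C v"
        using w P unfolding eta_GClosurePoint_iff by blast
      then show ?thesis
        using w(1) by (auto simp: eta_pt_union GPointOpen_def)
    qed
    then show ?thesis
      using P by (auto simp: eta_GClosurePoint_iff)
  qed
  ultimately show ?thesis
    by (auto simp: pt_eq_def eta_pt_union)
qed

text \<open>An open neighbourhood that shares a ball \<open>C\<close> with the closure of \<open>u\<close> is itself an open
  neighbourhood of \<open>C\<close>, so it meets \<open>u\<close>.\<close>

lemma GClosurePoint_idem: "GClosurePoint (GClosurePoint u) =\<^sub>p\<^sub>t GClosurePoint u"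
proof -
  have "\<eta> P (GClosurePoint u)" if "\<eta> P (GClosurePoint (GClosurePoint u))" for P
    using that unfolding eta_GClosurePoint_iff by blast
  then show ?thesis
    using GClosurePoint_extensive by (auto simp: pt_eq_def pt_subseteq_def)
qed

end

theorem theorem22:
  fixes u v :: "'n::ball_geometry"
  shows "GClosurePoint (\<Lambda> :: 'n) =\<^sub>p\<^sub>t \<Lambda> \<and>
    u \<subseteq>\<^sub>p\<^sub>t GClosurePoint u \<and>
    GClosurePoint (u \<union>\<^sub>p\<^sub>t v) =\<^sub>p\<^sub>t GClosurePoint u \<union>\<^sub>p\<^sub>t GClosurePoint v \<and>
    GClosurePoint (GClosurePoint u) =\<^sub>p\<^sub>t GClosurePoint u"
  by (intro conjI GClosurePoint_Lambda GClosurePoint_extensive GClosurePoint_union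
      GClosurePoint_idem)

end
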